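(* The map $\psi:\mathcal J\mapsto R_{\mathcal J}$ is a bijection from the set of positive geometric chains of ideals in $\Phi^+$ of length $m$ to the set of bounded dominant regions of $\mathcal A^m_\Phi$. Its inverse $\phi$ sends a bounded dominant region $R$ to the chain $\emptyset=\mathcal J_0\subseteq\mathcal J_1\subseteq\cdots\subseteq\mathcal J_m$, where $\mathcal J_r$ is the set of $\alpha\in\Phi^+$ such that $(\alpha,x)<r$ for $x\in R$.
   Context: $\Phi$ is an irreducible crystallographic root system of rank $\ell$ in Euclidean $V$ with positive system $\Phi^+$ and simple roots $\Pi$; $m\ge1$. $\mathcal A^m_\Phi$ is the arrangement of hyperplanes $H_{\alpha,k}=\{x:(\alpha,x)=k\}$, $\alpha\in\Phi$, $k=0,\dots,m$; dominant means contained in $\{x:(\alpha,x)>0\ \forall \alpha\in\Phi^+\}$. Root poset: $\alpha\le\beta$ iff $\beta-\alpha$ is a nonnegative combination of positive roots; ideals are down-closed subsets. A geometric chain of ideals of length $m$ is a chain of ideals $\emptyset=\mathcal J_0\subseteq\cdots\subseteq\mathcal J_m$ with $(\mathcal J_i+\mathcal J_j)\cap\Phi^+\subseteq\mathcal J_{i+j}$ for $i+j\le m$ and $(\mathcal I_i+\mathcal I_j)\cap\Phi^+\subseteq\mathcal I_{i+j}$ for all $i,j\ge0$, where $\mathcal I_i=\Phi^+\setminus\mathcal J_i$ for $i\le m$ and $\mathcal I_i=\mathcal I_m$ for $i>m$; positive if $\Pi\subseteq\mathcal J_m$. $R_{\mathcal J}$ is the set of $x\in V$ with, for each $0\le r\le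 m$, $(\alpha,x)>r$ for $\alpha\in\mathcal I_r$ and $0<(\alpha,x)<r$ for $\alpha\in\mathcal J_r$. *)

theory Defs
  imports "HOL-Analysis.Analysis"
begin

definition crystallographic_root_system :: "'a::euclidean_space set \<Rightarrow> bool" where
  "crystallographic_root_system Phi \<longleftrightarrow>
     finite Phi \<and> 0 \<notin> Phi \<and> span Phi = UNIV \<and>
     (\<forall>\<alpha>\<in>Phi. \<forall>c::real. c *\<^sub>R \<alpha> \<in> Phi \<longleftrightarrow> c = 1 \<or> c = -1) \<and>
     (\<forall>\<alpha>\<in>Phi. \<forall>\<beta>\<in>Phi. \<beta> - (2 * (\<beta> \<bullet> \<alpha>) / (\<alpha> \<bullet> \<alpha>)) *\<^sub>R \<alpha> \<in> Phi) \<and>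
     (\<forall>\<alpha>\<in>Phi. \<forall>\<beta>\<in>Phi. 2 * (\<beta> \<bullet> \<alpha>) / (\<alpha> \<bullet> \<alpha>) \<in> \<int>)"

definition irreducible_root_system :: "'a::euclidean_space set \<Rightarrow> bool" where
  "irreducible_root_system Phi \<longleftrightarrow>
     \<not> (\<exists>A B. A \<noteq> {} \<and> B \<noteq> {} \<and> A \<union> B = Phi \<and> A \<inter> B = {} \<and>
            (\<forall>a\<in>A. \<forall>b\<in>B. a \<bullet> b = 0))"

definition positive_system :: "'a::euclidean_space set \<Rightarrow> 'a set \<Rightarrow> bool" where
  "positive_system Phi Pos \<longleftrightarrow>
     (\<exists>v. (\<forall>\<alpha>\<in>Phi. \<alpha> \<bullet> v \<noteq> 0) \<and> Pos = {\<alpha>\<in>Phi. \<alpha> \<bullet> v > 0})"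

definition simple_roots :: "'a::euclidean_space set \<Rightarrow> 'a set" where
  "simple_roots Pos = {\<alpha>\<in>Pos. \<not> (\<exists>\<beta>\<in>Pos. \<exists>\<gamma>\<in>Pos. \<alpha> = \<beta> + \<gamma>)}"

definition root_le :: "'a::euclidean_space set \<Rightarrow> 'a \<Rightarrow> 'a \<Rightarrow> bool" where
  "root_le Pos \<alpha> \<beta> \<longleftrightarrow>
     (\<exists>c. (\<forall>\<gamma>\<in>Pos. c \<gamma> \<ge> (0::real)) \<and> \<beta> - \<alpha> = (\<Sum>\<gamma>\<in>Pos. c \<gamma> *\<^sub>R \<gamma>))"

definition root_ideal :: "'a::euclidean_space set \<Rightarrow> 'a set \<Rightarrow> bool" where
  "root_ideal Pos J \<longleftrightarrow> J \<subseteq> Pos \<and> (\<forall>\<beta>\<in>J. \<forall>\<alpha>\<in>Pos. root_le Pos \<alpha> \<beta> \<longrightarrow> \<alpha> \<in> J)"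

definition setsum :: "'a::euclidean_space set \<Rightarrow> 'a set \<Rightarrow> 'a set" where
  "setsum A B = {a + b | a b. a \<in> A \<and> b \<in> B}"

definition chain_I :: "'a::euclidean_space set \<Rightarrow> nat \<Rightarrow> (nat \<Rightarrow> 'a set) \<Rightarrow> nat \<Rightarrow> 'a set" where
  "chain_I Pos m J i = Pos - J (min i m)"

text \<open>A geometric chain of ideals of length m, represented as J :: nat => 'a set,
  normalized by J i = J m for i > m (only J 0, ..., J m carry information).\<close>
definition geometric_chain :: "'a::euclidean_space set \<Rightarrow> nat \<Rightarrow> (nat \<Rightarrow> 'a set) \<Rightarrow> bool" where
  "geometric_chain Pos m J \<longleftrightarrow>
     J 0 = {} \<and>
     (\<forall>i<m. J i \<subseteq> J (Suc i)) \<and>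
     (\<forall>i\<le>m. root_ideal Pos (J i)) \<and>
     (\<forall>i j. i + j \<le> m \<longrightarrow> setsum (J i) (J j) \<inter> Pos \<subseteq> J (i + j)) \<and>
     (\<forall>i j. setsum (chain_I Pos m J i) (chain_I Pos m J j) \<inter> Pos \<subseteq> chain_I Pos m J (i + j)) \<and>
     (\<forall>i>m. J i = J m)"

definition positive_geometric_chains :: "'a::euclidean_space set \<Rightarrow> nat \<Rightarrow> (nat \<Rightarrow> 'a set) set" where
  "positive_geometric_chains Pos m =
     {J. geometric_chain Pos m J \<and> simple_roots Pos \<subseteq> J m}"

definition arrangement_hyperplanes :: "'a::euclidean_space set \<Rightarrow> nat \<Rightarrow> 'a set set" where
  "arrangement_hyperplanes Phi m = {{x. \<alpha> \<bullet> x = real k} | \<alpha> k. \<alpha> \<in> Phi \<and> k \<le> m}"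

definition arrangement_regions :: "'a::euclidean_space set \<Rightarrow> nat \<Rightarrow> 'a set set" where
  "arrangement_regions Phi m = components (UNIV - \<Union> (arrangement_hyperplanes Phi m))"

definition dominant_chamber :: "'a::euclidean_space set \<Rightarrow> 'a set" where
  "dominant_chamber Pos = {x. \<forall>\<alpha>\<in>Pos. \<alpha> \<bullet> x > 0}"

definition bounded_dominant_regions :: "'a::euclidean_space set \<Rightarrow> 'a set \<Rightarrow> nat \<Rightarrow> 'a set set" where
  "bounded_dominant_regions Phi Pos m =
     {R \<in> arrangement_regions Phi m. R \<subseteq> dominant_chamber Pos \<and> bounded R}"

definition region_of_chain :: "'a::euclidean_space set \<Rightarrow> nat \<Rightarrow> (nat \<Rightarrow> 'a set) \<Rightarrow> 'a set" where
  "region_of_chain Pos m J =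
     {x. \<forall>r\<le>m. (\<forall>\<alpha>\<in>chain_I Pos m J r. \<alpha> \<bullet> x > real r) \<and>
                (\<forall>\<alpha>\<in>J r. 0 < \<alpha> \<bullet> x \<and> \<alpha> \<bullet> x < real r)}"

definition chain_of_region :: "'a::euclidean_space set \<Rightarrow> nat \<Rightarrow> 'a set \<Rightarrow> nat \<Rightarrow> 'a set" where
  "chain_of_region Pos m R r = {\<alpha>\<in>Pos. \<forall>x\<in>R. \<alpha> \<bullet> x < real (min r m)}"

end

theory Submission
  imports Defs
begin

text \<open>The delicate point is that \<open>region_of_chain Pos m J\<close> is nonempty. If the system of strict
  inequalities defining it were infeasible, a Farkas certificate with integer coefficients would
  give roots \<open>a\<^sub>1 + \<dots> + a\<^sub>p = b\<^sub>1 + \<dots> + b\<^sub>q\<close>, not both sums empty, with \<open>a\<^sub>i\<close> outside \<open>J k\<^sub>i\<close>,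
  \<open>b\<^sub>j\<close> in \<open>J r\<^sub>j\<close> and \<open>\<Sum>k\<^sub>i \<ge> \<Sum>r\<^sub>j\<close>. The common sum has positive norm, so some
  \<open>a\<^sub>i \<bullet> b\<^sub>j > 0\<close> and \<open>a\<^sub>i - b\<^sub>j\<close> is zero or a root; the two closure conditions on a geometric
  chain are exactly what is needed to replace the pair \<open>a\<^sub>i, b\<^sub>j\<close> by this difference without losing
  the inequality. Each step shortens the relation, and cancelling an equal pair makes the inequality strict,
  a contradiction.

  A bounded dominant region lies below level \<open>m\<close> on every simple root \<open>a\<close>, since otherwise it would
  contain a ray in the direction of the fundamental coweight dual to \<open>a\<close>.\<close>

section \<open>Sums over multisets\<close>

lemma sum_mset_sum_replicate:
  fixes f :: "'b \<Rightarrow> 'c::real_vector" and c :: "'b \<Rightarrow> nat"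
  assumes "finite S"
  shows "(\<Sum>x\<in>#(\<Sum>z\<in>S. replicate_mset (c z) z). f x) = (\<Sum>z\<in>S. real (c z) *\<^sub>R f z)"
proof -
  have rep: "(\<Sum>x\<in>#replicate_mset k z. f x) = real k *\<^sub>R f z" for k z
    by (induction k) (simp_all add: algebra_simps)
  show ?thesis
    using assms by (induction S rule: finite_induct) (simp_all add: rep del: image_replicate_mset)
qed

lemma set_mset_sum_replicate:
  assumes "finite S"
  shows "set_mset (\<Sum>z\<in>S. replicate_mset (c z) z) = {z\<in>S. c z \<noteq> 0}"
  using assms
proof (induction S rule: finite_induct)
  case (insert x S)
  show ?case
    unfolding sum.insert[OF insert.hyps] set_mset_union insert.IH by (cases "c x") auto
qed simp

lemma sum_mset_pos_ex:
  fixes f :: "'b \<Rightarrow> real"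
  assumes "(\<Sum>x\<in>#M. f x) > 0"
  obtains x where "x \<in># M" "f x > 0"
proof -
  have "\<exists>x\<in>#M. f x > 0" using assms
  proof (induction M)
    case (add y M)
    then show ?case by (cases "f y > 0") auto
  qed simp
  then show ?thesis using that by blast
qed

lemma sum_mset_pos:
  fixes f :: "'b \<Rightarrow> real"
  assumes "M \<noteq> {#}" "\<And>x. x \<in># M \<Longrightarrow> f x > 0"
  shows "(\<Sum>x\<in>#M. f x) > 0"
  using assms
proof (induction M)
  case (add y M)
  then show ?case by (cases "M = {#}") (auto intro: add_pos_pos)
qed simp

lemma sum_mset_negf: "(\<Sum>x\<in>#M. - f x) = - (\<Sum>x\<in>#M. f x :: real)"
  by (induction M) simp_all

lemma inner_sum_mset_left:
  fixes f :: "'b \<Rightarrow> 'a::real_inner"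
  shows "(\<Sum>x\<in>#M. f x) \<bullet> y = (\<Sum>x\<in>#M. f x \<bullet> y)"
  by (induction M) (simp_all add: inner_add_left)

section \<open>Finite linear systems: infeasibility certificates and boundedness\<close>

text \<open>A Farkas alternative, obtained by adjoining \<open>(0, -1)\<close> to \<open>S\<close>
  and asking whether 0 lies in the convex hull. If not, a separating functional
  \<open>(x, t)\<close> has \<open>t < 0\<close>, and rescaling \<open>x\<close> by
  \<open>- t\<close> solves the system. If so, the convex weights are the certificate: the weight of
  \<open>(0, -1)\<close> equals the weighted sum of the bounds, so that sum is nonnegative, and the
  weights on \<open>S\<close> cannot all vanish since then this weight would vanish too.\<close>

lemma infeasible_certificate:
  fixes S :: "('a::euclidean_space \<times> real) set"
  assumes fin: "finite S" and nz: "\<forall>z\<in>S. fst z \<noteq> 0"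
    and infeasible: "\<not> (\<exists>x. \<forall>(a, b)\<in>S. b < a \<bullet> x)"
  shows "\<exists>u. (\<forall>z\<in>S. u z \<ge> 0) \<and> (\<exists>z\<in>S. u z > 0) \<and>
    (\<Sum>z\<in>S. u z *\<^sub>R fst z) = 0 \<and> (\<Sum>z\<in>S. u z * snd z) \<ge> 0"
proof -
  define T where "T = insert ((0::'a), -1::real) S"
  have finT: "finite T" and notin: "(0, -1) \<notin> S" using fin nz by (auto simp: T_def)
  have "0 \<in> convex hull T"
  proof (rule ccontr)
    assume "0 \<notin> convex hull T"
    moreover have "closed (convex hull T)"
      using finT finite_imp_compact_convex_hull compact_imp_closed by blast
    ultimately obtain w d where d: "0 < d" and w: "\<And>y. y \<in> convex hull T \<Longrightarrow> d < w \<bullet> y"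
      using separating_hyperplane_closed_0[OF convex_convex_hull] by metis
    obtain x t where wxt: "w = (x, t)" by (cases w)
    have w': "0 < w \<bullet> y" if "y \<in> T" for y
      using w[OF hull_inc[OF that]] d by linarith
    have t: "t < 0" using w'[of "(0, -1)"] by (simp add: T_def wxt)
    have "b < a \<bullet> (x /\<^sub>R (- t))" if "(a, b) \<in> S" for a b
    proof -
      have "0 < x \<bullet> a + t * b" using w'[of "(a, b)"] that by (simp add: T_def wxt)
      with t show ?thesis by (simp add: field_simps inner_commute)
    qed
    with infeasible show False by blast
  qed
  then obtain u where u: "\<And>y. y \<in> T \<Longrightarrow> 0 \<le> u y" "sum u T = 1" "(\<Sum>y\<in>T. u y *\<^sub>R y) = 0"
    unfolding convex_hull_finite[OF finT] by blast
  have split0: "u (0, -1) *\<^sub>R (0, -1) + (\<Sum>y\<in>S. u y *\<^sub>R y) = 0"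
    using u(3) fin notin by (simp add: T_def)
  have f: "(\<Sum>y\<in>S. u y *\<^sub>R fst y) = 0"
    using arg_cong[OF split0, of fst] by (simp add: fst_sum)
  have s: "(\<Sum>y\<in>S. u y * snd y) = u (0, -1)"
    using arg_cong[OF split0, of snd] by (simp add: snd_sum)
  have u0: "u (0, -1) \<ge> 0" using u(1) by (simp add: T_def)
  have "\<exists>z\<in>S. u z > 0"
  proof (rule ccontr)
    assume "\<not> ?thesis"
    then have z: "u z = 0" if "z \<in> S" for z
      using u(1)[of z] that by (force simp: T_def)
    then have "u (0, -1) = 0" using s by simp
    then show False using u(2) z fin notin by (simp add: T_def)
  qed
  then show ?thesis using u(1) f s u0 by (intro exI[of _ u]) (simp add: T_def)
qed

text \<open>A real Farkas certificate is turned into an integral one by simultaneous Diophantine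
  approximation: discreteness makes the approximate linear relation exact.\<close>

lemma discrete_strict_system_solvable:
  fixes S :: "('a::euclidean_space \<times> real) set"
  assumes fin: "finite S" and nz: "\<forall>z\<in>S. fst z \<noteq> 0"
    and ints: "\<forall>z\<in>S. snd z \<in> \<int>"
    and e: "e > 0"
    and discrete: "\<And>p :: 'a \<times> real \<Rightarrow> int.
      norm (\<Sum>z\<in>S. of_int (p z) *\<^sub>R fst z) < e \<Longrightarrow> (\<Sum>z\<in>S. of_int (p z) *\<^sub>R fst z) = 0"
    and relations: "\<And>M. set_mset M \<subseteq> S \<Longrightarrow> M \<noteq> {#} \<Longrightarrow> (\<Sum>z\<in>#M. fst z) = 0 \<Longrightarrow> (\<Sum>z\<in>#M. snd z) < 0"
  shows "\<exists>x. \<forall>(a, b)\<in>S. b < a \<bullet> x"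
proof (rule ccontr)
  assume "\<not> ?thesis"
  from infeasible_certificate[OF fin nz this]
  obtain u where u: "\<And>z. z \<in> S \<Longrightarrow> u z \<ge> 0" "\<exists>z\<in>S. u z > 0"
    "(\<Sum>z\<in>S. u z *\<^sub>R fst z) = 0" "(\<Sum>z\<in>S. u z * snd z) \<ge> 0" by blast
  obtain z0 where z0: "z0 \<in> S" "u z0 > 0" using u(2) by blast
  \<comment> \<open>When every coefficient is perturbed by less than \<open>1 / N\<close>,
    \<open>K / N\<close> bounds the error in the vector relation and \<open>L / N\<close> the error
    in the sum of the levels.\<close>
  define K where "K = (\<Sum>z\<in>S. norm (fst z))"
  define L where "L = (\<Sum>z\<in>S. \<bar>snd z\<bar>)"
  have K0: "K \<ge> 0" and L0: "L \<ge> 0" by (simp_all add: K_def L_def sum_nonneg)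
  \<comment> \<open>\<open>N\<close> exceeds three thresholds at once: \<open>K / N < e\<close> to
    invoke discreteness, \<open>L / N < 1\<close> to round the level sum, and
    \<open>1 / N < u z0\<close> to keep one coefficient positive.\<close>
  obtain N :: nat where N: "K / e + L + 1 / u z0 < real N" using reals_Archimedean2 by blast
  have pos: "K / e \<ge> 0" "1 / u z0 > 0" using K0 e z0 by auto
  have N0: "real N > 0" and N1: "K / e < real N" and N2: "L < real N" and N3: "1 / u z0 < real N"
    using N pos L0 by linarith+
  have KN: "1 / N * K < e" and LN: "1 / N * L < 1" and uN: "1 / N < u z0"
    using N0 N1 N2 N3 e z0 by (simp_all add: field_simps)
  obtain h where h: "bij_betw h {0..<card S} S" using ex_bij_betw_nat_finite[OF fin] by blast
  have "N > 0" using N0 by simp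
  then obtain q p where q: "0 < q"
    and p: "\<And>i. i < card S \<Longrightarrow> \<bar>of_int q * u (h i) - of_int (p i)\<bar> < 1 / N"
    using Dirichlet_approx_simult[of N "card S" "\<lambda>i. u (h i)"] by metis
  \<comment> \<open>The Dirichlet numerators \<open>p\<close> are indexed by
    \<open>0..<card S\<close>; \<open>P\<close> carries them back to the elements of
    \<open>S\<close>.\<close>
  define P where "P z = p (the_inv_into {0..<card S} h z)" for z
  have P: "\<bar>of_int q * u z - of_int (P z)\<bar> < 1 / N" if "z \<in> S" for z
  proof -
    have "the_inv_into {0..<card S} h z \<in> {0..<card S}"
      using bij_betwE[OF bij_betw_the_inv_into[OF h]] that by blast
    moreover have "h (the_inv_into {0..<card S} h z) = z"
      using h that by (simp add: bij_betw_def f_the_inv_into_f)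
    ultimately show ?thesis using p[of "the_inv_into {0..<card S} h z"] by (simp add: P_def)
  qed
  have N1': "1 / real N \<le> 1" using \<open>N > 0\<close> by simp
  have P0: "P z \<ge> 0" if "z \<in> S" for z
  proof -
    have "of_int q * u z \<ge> 0" using q u(1)[OF that] by simp
    then have "real_of_int (P z) > -1" using P[OF that] N1' by linarith
    then show ?thesis by linarith
  qed
  \<comment> \<open>Since \<open>q\<close> is at least 1, \<open>q * u z0\<close> stays above the
    approximation error, so the integral relation is not trivial.\<close>
  have Pz0: "P z0 > 0"
  proof -
    have "1 * u z0 \<le> of_int q * u z0" using q z0 by (intro mult_right_mono) auto
    then have "real_of_int (P z0) > 0" using P[OF z0(1)] uN by linarith
    then show ?thesis by simp
  qed
  have zero: "(\<Sum>z\<in>S. of_int (P z) *\<^sub>R fst z) = 0"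
  proof (rule discrete)
    have "(\<Sum>z\<in>S. of_int (P z) *\<^sub>R fst z)
        = (\<Sum>z\<in>S. of_int (P z) *\<^sub>R fst z) - of_int q *\<^sub>R (\<Sum>z\<in>S. u z *\<^sub>R fst z)"
      using u(3) by simp
    also have "\<dots> = (\<Sum>z\<in>S. (of_int (P z) - of_int q * u z) *\<^sub>R fst z)"
      by (simp add: scaleR_sum_right sum_subtractf scaleR_diff_left)
    also have "norm \<dots> \<le> (\<Sum>z\<in>S. 1 / N * norm (fst z))"
    proof (rule sum_norm_le)
      fix z assume "z \<in> S"
      then show "norm ((of_int (P z) - of_int q * u z) *\<^sub>R fst z) \<le> 1 / N * norm (fst z)"
        using P[of z] by (simp only: norm_scaleR) (intro mult_right_mono, auto)
    qed
    also have "\<dots> = 1 / N * K" by (simp add: K_def sum_distrib_left)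
    finally show "norm (\<Sum>z\<in>S. of_int (P z) *\<^sub>R fst z) < e" using KN by linarith
  qed
  \<comment> \<open>Rounding lowers the nonnegative sum
    \<open>q * (\<Sum>z\<in>S. u z * snd z)\<close> by less than 1. The result is an integer greater
    than -1, hence nonnegative.\<close>
  have nonneg: "(\<Sum>z\<in>S. of_int (P z) * snd z) \<ge> 0"
  proof -
    have "of_int q * (\<Sum>z\<in>S. u z * snd z) - (\<Sum>z\<in>S. of_int (P z) * snd z)
        = (\<Sum>z\<in>S. (of_int q * u z - of_int (P z)) * snd z)"
      by (simp add: sum_distrib_left sum_subtractf left_diff_distrib mult.assoc)
    also have "\<dots> \<le> (\<Sum>z\<in>S. 1 / N * \<bar>snd z\<bar>)"
    proof (rule sum_mono)
      fix z assume z: "z \<in> S"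
      have "(of_int q * u z - of_int (P z)) * snd z \<le> \<bar>of_int q * u z - of_int (P z)\<bar> * \<bar>snd z\<bar>"
        by (metis abs_ge_self abs_mult)
      also have "\<dots> \<le> 1 / N * \<bar>snd z\<bar>" using P[OF z] by (intro mult_right_mono) auto
      finally show "(of_int q * u z - of_int (P z)) * snd z \<le> 1 / N * \<bar>snd z\<bar>" .
    qed
    also have "\<dots> = 1 / N * L" by (simp add: L_def sum_distrib_left)
    finally have "(\<Sum>z\<in>S. of_int (P z) * snd z) > of_int q * (\<Sum>z\<in>S. u z * snd z) - 1"
      using LN by linarith
    moreover have "of_int q * (\<Sum>z\<in>S. u z * snd z) \<ge> 0" using q u(4) by simp
    ultimately have gt: "(\<Sum>z\<in>S. of_int (P z) * snd z) > -1" by linarith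
    have "(\<Sum>z\<in>S. of_int (P z) * snd z) \<in> \<int>" using ints by (intro Ints_sum Ints_mult) auto
    with gt show ?thesis by (elim Ints_cases) simp
  qed
  define M where "M = (\<Sum>z\<in>S. replicate_mset (nat (P z)) z)"
  have "set_mset M \<subseteq> S" and "M \<noteq> {#}"
    using set_mset_sum_replicate[OF fin, of "\<lambda>z. nat (P z)"] z0 Pz0 by (auto simp: M_def)
  moreover have "(\<Sum>z\<in>#M. fst z) = 0"
    unfolding M_def sum_mset_sum_replicate[OF fin] using zero P0 by simp
  ultimately have "(\<Sum>z\<in>#M. snd z) < 0" by (rule relations)
  moreover have "(\<Sum>z\<in>#M. snd z) \<ge> 0"
    unfolding M_def sum_mset_sum_replicate[OF fin] using nonneg P0 by simp
  ultimately show False by simp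
qed

text \<open>Every vector is a combination of elements of \<open>B\<close>, so every linear
  functional, in particular every coordinate, is bounded on \<open>R\<close>.\<close>

lemma bounded_if_inner_bounded_on_spanning:
  fixes B R :: "'a::euclidean_space set"
  assumes "finite B" "span B = UNIV" and bd: "\<And>b x. b \<in> B \<Longrightarrow> x \<in> R \<Longrightarrow> \<bar>b \<bullet> x\<bar> \<le> C"
  shows "bounded R"
proof -
  have "\<exists>D. \<forall>x\<in>R. \<bar>a \<bullet> x\<bar> \<le> D" for a
  proof -
    have "a \<in> range (\<lambda>u. \<Sum>b\<in>B. u b *\<^sub>R b)" using assms span_finite by blast
    then obtain u where a: "a = (\<Sum>b\<in>B. u b *\<^sub>R b)" by blast
    have "\<bar>a \<bullet> x\<bar> \<le> (\<Sum>b\<in>B. \<bar>u b\<bar> * C)" if "x \<in> R" for x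
    proof -
      have "\<bar>a \<bullet> x\<bar> \<le> (\<Sum>b\<in>B. \<bar>u b * (b \<bullet> x)\<bar>)"
        unfolding a by (simp add: inner_sum_left sum_abs)
      also have "\<dots> \<le> (\<Sum>b\<in>B. \<bar>u b\<bar> * C)"
        using bd that by (intro sum_mono) (simp add: abs_mult mult_left_mono)
      finally show ?thesis .
    qed
    then show ?thesis by blast
  qed
  then obtain D where D: "\<And>a x. x \<in> R \<Longrightarrow> \<bar>a \<bullet> x\<bar> \<le> D a" by metis
  have "norm x \<le> (\<Sum>i\<in>Basis. D i)" if "x \<in> R" for x
  proof -
    have "norm x \<le> (\<Sum>i\<in>Basis. \<bar>x \<bullet> i\<bar>)" by (rule norm_le_l1)
    also have "\<dots> \<le> (\<Sum>i\<in>Basis. D i)" using D[OF that] by (intro sum_mono) (simp add: inner_commute)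
    finally show ?thesis .
  qed
  then show ?thesis by (auto simp: bounded_iff)
qed

section \<open>Differences of roots\<close>

lemma root_uminus:
  assumes "crystallographic_root_system Phi" "a \<in> Phi"
  shows "- a \<in> Phi"
proof -
  have "(-1) *\<^sub>R a \<in> Phi" using assms unfolding crystallographic_root_system_def by blast
  then show ?thesis by simp
qed

text \<open>The Cartan integers \<open>m\<close> and \<open>n\<close> of the pair are positive, and
  their product is 4 times the squared cosine of the angle, hence below 4 for non-proportional
  roots. So one of them is 1, and the corresponding reflection produces \<open>a - b\<close> or
  \<open>b - a\<close>.\<close>

lemma root_diff:
  assumes cr: "crystallographic_root_system Phi" and a: "a \<in> Phi" and b: "b \<in> Phi"
    and pos: "a \<bullet> b > 0" and ne: "a \<noteq> b"
  shows "a - b \<in> Phi"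
proof -
  have refl: "y - (2 * (y \<bullet> x) / (x \<bullet> x)) *\<^sub>R x \<in> Phi" "2 * (y \<bullet> x) / (x \<bullet> x) \<in> \<int>"
    if "x \<in> Phi" "y \<in> Phi" for x y
    using cr that unfolding crystallographic_root_system_def by blast+
  have nz: "a \<noteq> 0" "b \<noteq> 0" using cr a b unfolding crystallographic_root_system_def by auto
  have sq: "a \<bullet> a > 0" "b \<bullet> b > 0" using nz by simp_all
  obtain m n :: int where m: "2 * (a \<bullet> b) / (b \<bullet> b) = m" and n: "2 * (b \<bullet> a) / (a \<bullet> a) = n"
    using refl(2)[OF b a] refl(2)[OF a b] by (auto elim!: Ints_cases)
  have "real_of_int m > 0" "real_of_int n > 0"
    unfolding m[symmetric] n[symmetric] using pos sq by (simp_all add: inner_commute[of b a])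
  then have m0: "m > 0" and n0: "n > 0" by simp_all
  have cs: "(a \<bullet> b)\<^sup>2 < (a \<bullet> a) * (b \<bullet> b)"
  proof (rule ccontr)
    assume "\<not> ?thesis"
    then have "(a \<bullet> b)\<^sup>2 = (a \<bullet> a) * (b \<bullet> b)" using Cauchy_Schwarz_ineq[of a b] by linarith
    \<comment> \<open>This squared norm is \<open>b \<bullet> b\<close> times the Cauchy-Schwarz
      defect. If it vanished, \<open>a\<close> would be a multiple of \<open>b\<close>, so
      \<open>b\<close> or \<open>- b\<close>; the first is excluded by \<open>ne\<close>, the second
      by \<open>pos\<close>.\<close>
    then have "norm ((b \<bullet> b) *\<^sub>R a - (a \<bullet> b) *\<^sub>R b) ^ 2 = 0"
      unfolding power2_norm_eq_inner
      by (simp add: inner_diff_left inner_diff_right inner_commute power2_eq_square algebra_simps)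
    then have "(b \<bullet> b) *\<^sub>R a = (a \<bullet> b) *\<^sub>R b" by simp
    then have "(1 / (b \<bullet> b)) *\<^sub>R ((b \<bullet> b) *\<^sub>R a) = (1 / (b \<bullet> b)) *\<^sub>R ((a \<bullet> b) *\<^sub>R b)"
      by (rule arg_cong)
    then have "a = ((a \<bullet> b) / (b \<bullet> b)) *\<^sub>R b" using sq by simp
    then obtain c where c: "a = c *\<^sub>R b" by (rule that)
    then have "c = 1 \<or> c = -1" using a b cr unfolding crystallographic_root_system_def by blast
    moreover have "c > 0" using pos sq unfolding c by (simp add: zero_less_mult_iff)
    ultimately show False using c ne by auto
  qed
  have "real_of_int (m * n) < 4"
  proof -
    have "real_of_int (m * n) = 4 * ((a \<bullet> b)\<^sup>2) / ((a \<bullet> a) * (b \<bullet> b))"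
      using m[symmetric] n[symmetric] by (simp add: inner_commute power2_eq_square)
    also have "\<dots> < 4" using cs sq by (simp add: divide_less_eq)
    finally show ?thesis .
  qed
  then have mn: "m * n < 4" by linarith
  have "m = 1 \<or> n = 1"
  proof (rule ccontr)
    assume "\<not> ?thesis"
    then have "m \<ge> 2" "n \<ge> 2" using m0 n0 by auto
    then have "2 * 2 \<le> m * n" by (intro mult_mono) auto
    with mn show False by simp
  qed
  then show ?thesis
  proof
    assume "m = 1"
    then show ?thesis using refl(1)[OF b a] m by simp
  next
    assume "n = 1"
    then have "b - a \<in> Phi" using refl(1)[OF a b] n by simp
    from root_uminus[OF cr this] show ?thesis by simp
  qed
qed

section \<open>Positive systems, simple roots and fundamental directions\<close>

text \<open>Fixing the regular vector \<open>v\<close> behind the positive system makes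
  \<open>a \<bullet> v\<close> available as an additive height that is positive on
  \<open>Pos\<close>.\<close>

locale root_positive_system =
  fixes Phi Pos :: "'a::euclidean_space set" and v :: 'a and m :: nat
  assumes cr: "crystallographic_root_system Phi"
    and regular: "\<And>a. a \<in> Phi \<Longrightarrow> a \<bullet> v \<noteq> 0"
    and Pos: "Pos = {a\<in>Phi. a \<bullet> v > 0}"
begin

lemma fin: "finite Phi" "finite Pos" "finite (simple_roots Pos)"
  using cr by (auto simp: crystallographic_root_system_def Pos simple_roots_def)

lemma PosD: "a \<in> Pos \<Longrightarrow> a \<in> Phi" "a \<in> Pos \<Longrightarrow> a \<bullet> v > 0"
  by (auto simp: Pos)

lemmas neg_root = root_uminus[OF cr]

lemma Phi_cases:
  assumes "a \<in> Phi" obtains "a \<in> Pos" | "- a \<in> Pos"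
proof -
  have "a \<bullet> v > 0 \<or> - a \<bullet> v > 0" using regular[OF assms] by auto
  then show ?thesis using that assms neg_root[OF assms] by (auto simp: Pos)
qed

lemma pos_root_diff:
  assumes "a \<in> Pos" "b \<in> Pos" "a \<bullet> b > 0" "a \<noteq> b"
  obtains "a - b \<in> Pos" | "b - a \<in> Pos"
proof -
  have "a - b \<in> Phi" by (rule root_diff[OF cr PosD(1)[OF assms(1)] PosD(1)[OF assms(2)] assms(3,4)])
  then show ?thesis using that by (cases rule: Phi_cases) auto
qed

lemma simple_rootsD: "a \<in> simple_roots Pos \<Longrightarrow> a \<in> Pos"
  by (simp add: simple_roots_def)

text \<open>A non-simple positive root splits into two positive roots of smaller height
  \<open>_ \<bullet> v\<close>. Heights are real numbers, so the descent is measured by how many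
  positive roots lie strictly lower.\<close>

lemma pos_root_induct [consumes 1, case_names simple add]:
  assumes "a \<in> Pos"
    and simple: "\<And>a. a \<in> simple_roots Pos \<Longrightarrow> P a"
    and add: "\<And>b c. b \<in> Pos \<Longrightarrow> c \<in> Pos \<Longrightarrow> b + c \<in> Pos \<Longrightarrow> P b \<Longrightarrow> P c \<Longrightarrow> P (b + c)"
  shows "P a"
  using \<open>a \<in> Pos\<close>
proof (induction "card {c\<in>Pos. c \<bullet> v < a \<bullet> v}" arbitrary: a rule: less_induct)
  case less
  show ?case
  proof (cases "a \<in> simple_roots Pos")
    case False
    then obtain b c where bc: "b \<in> Pos" "c \<in> Pos" "a = b + c"
      using less.prems by (auto simp: simple_roots_def)
    have lt: "b \<bullet> v < a \<bullet> v" "c \<bullet> v < a \<bullet> v"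
      using PosD(2)[OF bc(1)] PosD(2)[OF bc(2)] by (simp_all add: bc(3) inner_add_left)
    have "card {e\<in>Pos. e \<bullet> v < d \<bullet> v} < card {e\<in>Pos. e \<bullet> v < a \<bullet> v}"
      if "d \<in> Pos" "d \<bullet> v < a \<bullet> v" for d
      using that fin(2) by (intro psubset_card_mono) auto
    then show ?thesis using add[of b c] bc less lt by blast
  qed (rule simple)
qed

text \<open>At an acute angle, \<open>a - b\<close> or \<open>b - a\<close> would be a positive
  root, and adding it back would decompose one of the two simple roots.\<close>

lemma simple_obtuse:
  assumes "a \<in> simple_roots Pos" "b \<in> simple_roots Pos" "a \<noteq> b"
  shows "a \<bullet> b \<le> 0"
proof (rule ccontr)
  assume "\<not> ?thesis"
  then have "a - b \<in> Pos \<or> b - a \<in> Pos"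
    using pos_root_diff[of a b] assms simple_rootsD by (metis not_le)
  moreover have "a = b + (a - b)" "b = a + (b - a)" by simp_all
  ultimately show False using assms unfolding simple_roots_def by blast
qed

lemma span_simple: "span (simple_roots Pos) = UNIV"
proof -
  have span: "a \<in> span (simple_roots Pos)" if "a \<in> Pos" for a
    using that by (induction rule: pos_root_induct) (auto intro: span_base span_add)
  have "Phi \<subseteq> span (simple_roots Pos)"
  proof
    fix a assume "a \<in> Phi"
    then show "a \<in> span (simple_roots Pos)"
      by (cases rule: Phi_cases) (use span span_neg[of "- a"] in auto)
  qed
  then have "span Phi \<subseteq> span (simple_roots Pos)" by (rule span_minimal) simp
  then show ?thesis using cr by (auto simp: crystallographic_root_system_def)
qed

text \<open>Pairwise obtuse vectors in an open half-space are independent. Separating the positive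
  from the negative coefficients of a relation gives \<open>a + N = P\<close> with
  \<open>P \<bullet> P = P \<bullet> a + P \<bullet> N \<le> 0\<close>, so \<open>P = 0\<close>,
  while \<open>a + N\<close> has positive height.\<close>

lemma simple_notin_span:
  assumes a: "a \<in> simple_roots Pos"
  shows "a \<notin> span (simple_roots Pos - {a})"
proof
  let ?B = "simple_roots Pos - {a}"
  assume "a \<in> span ?B"
  then obtain u where u: "a = (\<Sum>b\<in>?B. u b *\<^sub>R b)"
    using span_finite[of ?B] fin(3) by (metis (no_types, lifting) finite_Diff imageE)
  define P where "P = (\<Sum>b\<in>?B. max (u b) 0 *\<^sub>R b)"
  define N where "N = (\<Sum>b\<in>?B. max (- u b) 0 *\<^sub>R b)"
  have uu: "u b = max (u b) 0 - max (- u b) 0" for b by simp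
  have PN: "a + N = P"
  proof -
    have "a = (\<Sum>b\<in>?B. (max (u b) 0 - max (- u b) 0) *\<^sub>R b)" using u uu by simp
    also have "\<dots> = P - N" by (simp add: P_def N_def scaleR_diff_left sum_subtractf)
    finally show ?thesis by simp
  qed
  have "P \<bullet> a \<le> 0"
    unfolding P_def inner_sum_left using simple_obtuse[OF _ a]
    by (intro sum_nonpos) (auto simp: mult_nonneg_nonpos)
  moreover have "P \<bullet> N \<le> 0"
    unfolding P_def N_def inner_sum_left inner_sum_right
  proof (intro sum_nonpos)
    \<comment> \<open>For \<open>b = c\<close> one of the two coefficients vanishes, as
      \<open>u b\<close> and \<open>- u b\<close> are not both positive; for
      \<open>b \<noteq> c\<close> obtuseness applies.\<close>
    fix b c assume bc: "b \<in> ?B" "c \<in> ?B"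
    have "max (u b) 0 * max (- u c) 0 * (b \<bullet> c) \<le> 0"
      using simple_obtuse[of b c] bc by (cases "b = c") (auto simp: max_def mult_nonneg_nonpos)
    then show "(max (u b) 0 *\<^sub>R b) \<bullet> (max (- u c) 0 *\<^sub>R c) \<le> 0" by (simp add: mult_ac)
  qed
  ultimately have "P \<bullet> P \<le> 0" by (metis PN add_nonpos_nonpos inner_add_right)
  then have "P = 0" by (metis inner_ge_zero inner_eq_zero_iff order_antisym)
  then have "a \<bullet> v + N \<bullet> v = 0" by (metis PN inner_add_left inner_zero_left)
  moreover have "N \<bullet> v \<ge> 0" unfolding N_def inner_sum_left
    using PosD(2) simple_rootsD by (intro sum_nonneg) (force simp: less_imp_le)
  ultimately show False using PosD(2)[OF simple_rootsD[OF a]] by linarith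
qed

text \<open>The component of \<open>a\<close> orthogonal to the other simple roots serves as
  \<open>w\<close>; it is nonzero by independence and is a positive multiple of the fundamental
  coweight dual to \<open>a\<close>.\<close>

lemma fundamental_direction:
  assumes a: "a \<in> simple_roots Pos"
  obtains w where "a \<bullet> w > 0" "\<And>b. b \<in> simple_roots Pos \<Longrightarrow> b \<noteq> a \<Longrightarrow> b \<bullet> w = 0"
proof -
  let ?B = "simple_roots Pos - {a}"
  obtain y w where y: "y \<in> span ?B" and w: "\<And>b. b \<in> span ?B \<Longrightarrow> orthogonal w b" and ayw: "a = y + w"
    using orthogonal_subspace_decomp_exists[of ?B a] by metis
  have "w \<noteq> 0" using simple_notin_span[OF a] y ayw by auto
  then have "w \<bullet> w > 0" by simp
  moreover have "y \<bullet> w = 0" using w[OF y] by (simp add: orthogonal_def inner_commute)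
  ultimately have "a \<bullet> w > 0" by (simp add: ayw inner_add_left)
  moreover have "b \<bullet> w = 0" if "b \<in> simple_roots Pos" "b \<noteq> a" for b
    using w[OF span_base] that by (simp add: orthogonal_def inner_commute)
  ultimately show ?thesis using that by blast
qed

text \<open>Positive pairing with \<open>w\<close> means that \<open>a\<close> occurs in
  \<open>b\<close> as a sum of simple roots; on the dominant chamber the remaining summands only
  increase the value at \<open>x\<close>. This controls every root along a ray in direction
  \<open>w\<close>.\<close>

lemma fundamental_direction_pos:
  assumes a: "a \<in> simple_roots Pos" and w: "a \<bullet> w > 0" "\<And>b. b \<in> simple_roots Pos \<Longrightarrow> b \<noteq> a \<Longrightarrow> b \<bullet> w = 0"
    and x: "x \<in> dominant_chamber Pos" and b: "b \<in> Pos"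
  shows "b \<bullet> w \<ge> 0 \<and> (b \<bullet> w > 0 \<longrightarrow> b \<bullet> x \<ge> a \<bullet> x)"
  using b
proof (induction rule: pos_root_induct)
  case (simple b)
  then show ?case using w by (cases "b = a") auto
next
  case (add b c)
  have "b \<bullet> x > 0" "c \<bullet> x > 0" using x add.hyps by (auto simp: dominant_chamber_def)
  then show ?case using add.IH by (auto simp: inner_add_left)
qed

text \<open>An integral combination of roots pairs integrally with every coroot. With
  \<open>D\<close> above all coroot norms, a combination shorter than \<open>1 / D\<close> has
  pairings of modulus below 1, hence zero, and is orthogonal to a spanning set. The indexing by
  \<open>f\<close> allows one root to occur with several levels.\<close>

lemma root_lattice_discrete:
  obtains e where "e > 0"
    "\<And>(S :: 'b set) f (p :: 'b \<Rightarrow> int). f ` S \<subseteq> Phi \<Longrightarrow> norm (\<Sum>z\<in>S. of_int (p z) *\<^sub>R f z) < e \<Longrightarrow>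
      (\<Sum>z\<in>S. of_int (p z) *\<^sub>R f z) = 0"
proof -
  define D where "D = 1 + (\<Sum>a\<in>Phi. norm ((2 / (a \<bullet> a)) *\<^sub>R a))"
  have D0: "D > 0" unfolding D_def by (intro add_pos_nonneg sum_nonneg) auto
  have "(\<Sum>z\<in>S. of_int (p z) *\<^sub>R f z) = 0"
    if f: "f ` S \<subseteq> Phi" and small: "norm (\<Sum>z\<in>S. of_int (p z) *\<^sub>R f z) < 1 / D" for S :: "'b set" and f p
  proof -
    define w where "w = (\<Sum>z\<in>S. of_int (p z) *\<^sub>R f z)"
    have "w \<bullet> a = 0" if a: "a \<in> Phi" for a
    proof -
      have a0: "a \<noteq> 0" using a cr unfolding crystallographic_root_system_def by auto
      let ?c = "(2 / (a \<bullet> a)) *\<^sub>R a"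
      have "w \<bullet> ?c = (\<Sum>z\<in>S. of_int (p z) * (2 * (f z \<bullet> a) / (a \<bullet> a)))"
        unfolding w_def inner_sum_left by (intro sum.cong) auto
      also have "\<dots> \<in> \<int>"
        using f a cr unfolding crystallographic_root_system_def
        by (intro Ints_sum Ints_mult Ints_of_int) blast
      finally have int: "w \<bullet> ?c \<in> \<int>" .
      have "norm ?c \<le> (\<Sum>a\<in>Phi. norm ((2 / (a \<bullet> a)) *\<^sub>R a))"
        by (rule member_le_sum[OF a]) (auto simp: fin)
      then have cD: "norm ?c \<le> D" by (simp add: D_def)
      have "\<bar>w \<bullet> ?c\<bar> \<le> norm w * norm ?c" by (rule Cauchy_Schwarz_ineq2)
      also have "\<dots> \<le> norm w * D" using cD by (intro mult_left_mono) auto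
      also have "\<dots> < 1" using small D0 by (simp add: w_def field_simps)
      finally have "\<bar>w \<bullet> ?c\<bar> < 1" .
      with int have "w \<bullet> ?c = 0" by (rule Ints_nonzero_abs_less1)
      then show ?thesis using a0 by simp
    qed
    then have "orthogonal w y" if "y \<in> span Phi" for y
      using orthogonal_to_span[OF that, of w] by (auto simp: orthogonal_def)
    then have "orthogonal w w" using cr by (simp add: crystallographic_root_system_def)
    then show ?thesis by (simp add: orthogonal_self w_def)
  qed
  then show ?thesis using that[of "1 / D"] D0 by simp
qed

lemma avoids_arrangement_iff:
  "x \<in> UNIV - \<Union> (arrangement_hyperplanes Phi m) \<longleftrightarrow> (\<forall>a\<in>Phi. \<forall>k\<le>m. a \<bullet> x \<noteq> real k)"
  by (auto simp: arrangement_hyperplanes_def)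

section \<open>The inequality system of a geometric chain and its consistency\<close>

text \<open>A pair \<open>(c, b)\<close> stands for \<open>b < c \<bullet> x\<close>; upper bounds
  are negated so that all inequalities point the same way. For a chain with \<open>J 0 = {}\<close>,
  positivity on \<open>Pos\<close> is the case \<open>r = 0\<close> of the first kind.\<close>

definition chain_constraints :: "(nat \<Rightarrow> 'a set) \<Rightarrow> ('a \<times> real) set" where
  "chain_constraints J = {(a, real r) | a r. r \<le> m \<and> a \<in> Pos - J r}
      \<union> {(- a, - real r) | a r. r \<le> m \<and> a \<in> J r}"

lemma chain_constraintsI:
  "a \<in> Pos \<Longrightarrow> a \<notin> J r \<Longrightarrow> r \<le> m \<Longrightarrow> (a, real r) \<in> chain_constraints J"
  "a \<in> J r \<Longrightarrow> r \<le> m \<Longrightarrow> (- a, - real r) \<in> chain_constraints J"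
  unfolding chain_constraints_def by blast+

context
  fixes J assumes J: "geometric_chain Pos m J"
begin

lemma chain_0: "J 0 = {}"
  using J by (simp add: geometric_chain_def)

lemma chain_subset: "r \<le> m \<Longrightarrow> J r \<subseteq> Pos"
  using J by (auto simp: geometric_chain_def root_ideal_def)

lemma chain_mono:
  assumes "r \<le> s" "s \<le> m" shows "J r \<subseteq> J s"
  using assms
proof (induction s rule: dec_induct)
  case (step s)
  moreover have "J s \<subseteq> J (Suc s)" using step.prems J by (auto simp: geometric_chain_def)
  ultimately show ?case by simp
qed simp

lemma chain_add:
  assumes "i + j \<le> m" "a \<in> J i" "b \<in> J j" "a + b \<in> Pos"
  shows "a + b \<in> J (i + j)"
proof -
  have "setsum (J i) (J j) \<inter> Pos \<subseteq> J (i + j)" using J assms(1) by (simp add: geometric_chain_def)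
  then show ?thesis using assms by (auto simp: setsum_def)
qed

lemma chain_add_compl:
  assumes "i + j \<le> m" "a \<in> Pos" "a \<notin> J i" "b \<in> Pos" "b \<notin> J j" "a + b \<in> Pos"
  shows "a + b \<notin> J (i + j)"
proof -
  have sub: "setsum (chain_I Pos m J i) (chain_I Pos m J j) \<inter> Pos \<subseteq> chain_I Pos m J (i + j)"
    using J unfolding geometric_chain_def by blast
  have "a \<in> chain_I Pos m J i" "b \<in> chain_I Pos m J j"
    using assms by (auto simp: chain_I_def min_def)
  then have "a + b \<in> chain_I Pos m J (i + j)" using sub assms(6) unfolding setsum_def by blast
  then show ?thesis using assms(1) by (simp add: chain_I_def min_def)
qed

text \<open>The sign of the height tells the two kinds apart: \<open>a\<close> lies outside
  \<open>J k\<close>, and \<open>b = - c\<close> with \<open>c\<close> in \<open>J r\<close>. If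
  \<open>a = c\<close>, monotonicity forces \<open>k < r\<close>. If \<open>a - c\<close> is
  positive, closure of the ideals under sums keeps it out of \<open>J (k - r)\<close>. If
  \<open>c - a\<close> is positive, closure of the complements puts it into
  \<open>J (r - k)\<close>.\<close>

lemma chain_constraints_merge:
  assumes z: "(a, s) \<in> chain_constraints J" "(b, t) \<in> chain_constraints J"
    and sgn: "a \<bullet> v > 0" "b \<bullet> v < 0" and ab: "a \<bullet> b < 0"
  shows "(a + b = 0 \<and> s + t < 0) \<or> (\<exists>u \<ge> s + t. (a + b, u) \<in> chain_constraints J)"
proof -
  have negJ: "- c \<bullet> v < 0" if "c \<in> J r" "r \<le> m" for c r
    using that chain_subset PosD(2) by auto
  obtain k where k: "k \<le> m" "s = real k" "a \<in> Pos" "a \<notin> J k"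
    using z(1) negJ sgn(1) by (force simp: chain_constraints_def)
  obtain c r where c: "r \<le> m" "t = - real r" "b = - c" "c \<in> J r"
    using z(2) PosD(2) sgn(2) by (force simp: chain_constraints_def)
  have cP: "c \<in> Pos" using c chain_subset by blast
  show ?thesis
  proof (cases "a = c")
    case True
    then have "k < r" using k c chain_mono[of r k] by (metis not_le subsetD)
    then show ?thesis using True k c by simp
  next
    case False
    have "a \<bullet> c > 0" using ab c(3) by simp
    from pos_root_diff[OF k(3) cP this False] show ?thesis
    proof cases
      case 1
      show ?thesis
      proof (cases "r \<le> k")
        case True
        have "a - c \<notin> J (k - r)"
          using chain_add[of "k - r" r "a - c" c] True k c by auto
        then have "(a - c, real (k - r)) \<in> chain_constraints J"
          using 1 k by (intro chain_constraintsI) auto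
        then show ?thesis using k c True by (intro disjI2 exI[of _ "real (k - r)"]) auto
      next
        case False
        \<comment> \<open>Here \<open>s + t = k - r\<close> is negative, so the level 0 bound,
          available for every positive root, is strong enough.\<close>
        have "(a - c, real 0) \<in> chain_constraints J"
          using 1 chain_0 by (intro chain_constraintsI) auto
        then show ?thesis using k c False by (intro disjI2 exI[of _ "real 0"]) auto
      qed
    next
      case 2
      \<comment> \<open>Otherwise \<open>c\<close> is in \<open>J k\<close>, but it is the sum of
        \<open>a\<close> outside \<open>J k\<close> and \<open>c - a\<close> outside
        \<open>J 0\<close>, so complement closure excludes it.\<close>
      have "k \<le> r"
      proof (rule ccontr)
        assume "\<not> ?thesis"
        then have "c \<in> J k" using chain_mono[of r k] k c by auto
        then show False using chain_add_compl[of k 0 a "c - a"] k cP 2 chain_0 by simp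
      qed
      then have "c - a \<in> J (r - k)"
        using chain_add_compl[of k "r - k" a "c - a"] k c cP 2 by auto
      then have "(- (c - a), - real (r - k)) \<in> chain_constraints J"
        using c by (intro chain_constraintsI) auto
      then show ?thesis using k c \<open>k \<le> r\<close> by (intro disjI2 exI[of _ "- real (r - k)"]) auto
    qed
  qed
qed

lemma chain_constraints_regular:
  assumes "z \<in> chain_constraints J"
  shows "fst z \<bullet> v \<noteq> 0"
  using assms chain_subset PosD(2) by (fastforce simp: chain_constraints_def)

text \<open>The part \<open>P\<close> of positive height has sum \<open>X\<close>, the part
  \<open>Q\<close> of negative height has sum \<open>- X\<close>. Expanding
  \<open>X \<bullet> X > 0\<close> over \<open>P\<close> yields \<open>p\<close> with
  \<open>fst p \<bullet> X > 0\<close>, and expanding this over \<open>Q\<close> yields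
  \<open>q\<close>.\<close>

lemma relation_opposite_pair:
  assumes M: "set_mset M \<subseteq> chain_constraints J" "M \<noteq> {#}" and zero: "(\<Sum>z\<in>#M. fst z) = 0"
  obtains p q N where "M = add_mset p (add_mset q N)"
    "fst p \<bullet> v > 0" "fst q \<bullet> v < 0" "fst p \<bullet> fst q < 0"
proof -
  define P Q where "P = filter_mset (\<lambda>z. fst z \<bullet> v > 0) M" and "Q = filter_mset (\<lambda>z. \<not> fst z \<bullet> v > 0) M"
  define X where "X = (\<Sum>z\<in>#P. fst z)"
  have MPQ: "M = P + Q" by (simp add: P_def Q_def)
  have Pv: "fst z \<bullet> v > 0" if "z \<in># P" for z using that by (simp add: P_def)
  have Qv: "fst z \<bullet> v < 0" if "z \<in># Q" for z
  proof -
    have "z \<in> chain_constraints J" using that M(1) by (auto simp: Q_def)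
    from chain_constraints_regular[OF this] show ?thesis using that by (simp add: Q_def)
  qed
  have QX: "(\<Sum>z\<in>#Q. fst z) = - X" using zero unfolding MPQ X_def by (simp add: eq_neg_iff_add_eq_0 add.commute)
  \<comment> \<open>One of \<open>P\<close> and \<open>Q\<close> is nonempty; if it is only
    \<open>Q\<close>, the height of \<open>X\<close> is read off from the sum \<open>- X\<close>
    over \<open>Q\<close>.\<close>
  have "X \<bullet> v > 0"
  proof (cases "P = {#}")
    case False
    then show ?thesis unfolding X_def inner_sum_mset_left by (intro sum_mset_pos Pv)
  next
    case True
    then have "Q \<noteq> {#}" using M(2) MPQ by simp
    then have "(\<Sum>z\<in>#Q. - fst z \<bullet> v) > 0" using Qv by (intro sum_mset_pos) auto
    then have "(\<Sum>z\<in>#Q. fst z) \<bullet> v < 0"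
      unfolding inner_sum_mset_left by (simp add: sum_mset_negf)
    then show ?thesis by (simp add: QX)
  qed
  then have "X \<noteq> 0" by auto
  then have "X \<bullet> X > 0" by simp
  then have "(\<Sum>z\<in>#P. fst z \<bullet> X) > 0" by (simp add: X_def inner_sum_mset_left)
  then obtain p where p: "p \<in># P" "fst p \<bullet> X > 0" by (rule sum_mset_pos_ex)
  then have "(- X) \<bullet> (- fst p) > 0" by (simp add: inner_commute)
  then have "(\<Sum>z\<in>#Q. fst z \<bullet> (- fst p)) > 0" unfolding QX[symmetric] inner_sum_mset_left .
  then obtain q where q: "q \<in># Q" "fst q \<bullet> (- fst p) > 0" by (rule sum_mset_pos_ex)
  obtain P' Q' where "P = add_mset p P'" "Q = add_mset q Q'"
    using p(1) q(1) by (metis mset_add)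
  then have "M = add_mset p (add_mset q (P' + Q'))" by (simp add: MPQ)
  then show ?thesis using that Pv[OF p(1)] Qv[OF q(1)] q(2) by (simp add: inner_commute)
qed

text \<open>This excludes every integral certificate of infeasibility. Merging an opposite pair
  shortens the relation without decreasing the sum of the levels, except when the pair cancels,
  where its own contribution is already negative.\<close>

lemma chain_constraints_relation:
  assumes "set_mset M \<subseteq> chain_constraints J" "M \<noteq> {#}" "(\<Sum>z\<in>#M. fst z) = 0"
  shows "(\<Sum>z\<in>#M. snd z) < 0"
  using assms
proof (induction "size M" arbitrary: M rule: less_induct)
  case less
  obtain p q N where M: "M = add_mset p (add_mset q N)"
    and pq: "fst p \<bullet> v > 0" "fst q \<bullet> v < 0" "fst p \<bullet> fst q < 0"
    using relation_opposite_pair[OF less.prems] by metis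
  have pqN: "p \<in> chain_constraints J" "q \<in> chain_constraints J" "set_mset N \<subseteq> chain_constraints J"
    using less.prems(1) by (auto simp: M)
  have N0: "fst p + fst q + (\<Sum>z\<in>#N. fst z) = 0"
    using less.prems(3) by (simp add: M add.assoc)
  have "(fst p + fst q = 0 \<and> snd p + snd q < 0) \<or>
      (\<exists>u \<ge> snd p + snd q. (fst p + fst q, u) \<in> chain_constraints J)"
    using chain_constraints_merge[of "fst p" "snd p" "fst q" "snd q"] pqN pq by simp
  then show ?case
  proof
    assume 0: "fst p + fst q = 0 \<and> snd p + snd q < 0"
    \<comment> \<open>The rest \<open>N\<close> may be empty and then contributes exactly 0;
      strictness comes from the cancelled pair.\<close>
    have "(\<Sum>z\<in>#N. snd z) \<le> 0"
    proof (cases "N = {#}")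
      case False
      then show ?thesis using less.hyps[of N] N0 0 pqN(3) by (simp add: M)
    qed simp
    then show ?thesis using 0 by (simp add: M)
  next
    assume "\<exists>u \<ge> snd p + snd q. (fst p + fst q, u) \<in> chain_constraints J"
    then obtain u where u: "u \<ge> snd p + snd q" "(fst p + fst q, u) \<in> chain_constraints J" by blast
    have "(\<Sum>z\<in>#add_mset (fst p + fst q, u) N. snd z) < 0"
      using less.hyps[of "add_mset (fst p + fst q, u) N"] N0 u(2) pqN(3) by (simp add: M)
    then show ?thesis using u(1) by (simp add: M)
  qed
qed

lemma finite_chain_constraints: "finite (chain_constraints J)"
proof -
  have "chain_constraints J \<subseteq> (Pos \<union> uminus ` Pos) \<times> (real ` {..m} \<union> (\<lambda>r. - real r) ` {..m})"
    using chain_subset by (fastforce simp: chain_constraints_def)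
  then show ?thesis by (rule finite_subset) (simp add: fin)
qed

lemma fst_chain_constraints: "fst ` chain_constraints J \<subseteq> Phi"
  using chain_subset PosD(1) neg_root by (fastforce simp: chain_constraints_def)

lemma region_of_chain_nonempty: "region_of_chain Pos m J \<noteq> {}"
proof -
  obtain e where e: "e > 0" "\<And>(S :: ('a \<times> real) set) f (p :: _ \<Rightarrow> int). f ` S \<subseteq> Phi \<Longrightarrow>
      norm (\<Sum>z\<in>S. of_int (p z) *\<^sub>R f z) < e \<Longrightarrow> (\<Sum>z\<in>S. of_int (p z) *\<^sub>R f z) = 0"
    using root_lattice_discrete by blast
  have "\<forall>z\<in>chain_constraints J. fst z \<noteq> 0"
    using chain_constraints_regular by fastforce
  moreover have "\<forall>z\<in>chain_constraints J. snd z \<in> \<int>"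
    by (auto simp: chain_constraints_def)
  ultimately obtain x where x: "\<forall>(a, b)\<in>chain_constraints J. b < a \<bullet> x"
    using discrete_strict_system_solvable[OF finite_chain_constraints _ _ e(1)
        e(2)[OF fst_chain_constraints] chain_constraints_relation] by blast
  have I: "real r < a \<bullet> x" if "r \<le> m" "a \<in> Pos" "a \<notin> J r" for a r
    using x chain_constraintsI(1)[of a J r] that by fastforce
  have "x \<in> region_of_chain Pos m J"
    unfolding region_of_chain_def
  proof (intro CollectI allI impI conjI ballI)
    fix r a assume r: "r \<le> m"
    show "real r < a \<bullet> x" if "a \<in> chain_I Pos m J r" using that r I by (simp add: chain_I_def)
    \<comment> \<open>Positivity is the level 0 constraint, as no root lies in
      \<open>J 0\<close>.\<close>
    show "0 < a \<bullet> x" if "a \<in> J r" using that r I[of 0 a] chain_subset chain_0 by auto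
    show "a \<bullet> x < real r" if "a \<in> J r" using x chain_constraintsI(2)[of a J r] that r by fastforce
  qed
  then show ?thesis by blast
qed

section \<open>The region cut out by a chain\<close>

lemma region_of_chain_inner:
  "x \<in> region_of_chain Pos m J \<Longrightarrow> a \<in> Pos \<Longrightarrow> r \<le> m \<Longrightarrow> a \<notin> J r \<Longrightarrow> real r < a \<bullet> x"
  "x \<in> region_of_chain Pos m J \<Longrightarrow> r \<le> m \<Longrightarrow> a \<in> J r \<Longrightarrow> a \<bullet> x < real r"
  by (simp_all add: region_of_chain_def chain_I_def)

lemma region_of_chain_dominant: "region_of_chain Pos m J \<subseteq> dominant_chamber Pos"
  using region_of_chain_inner(1)[where r = 0] chain_0 by (auto simp: dominant_chamber_def)

text \<open>A point of the region is essential: over an empty region \<open>chain_of_region\<close>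
  would hold vacuously for all positive roots. At such a point, a root outside
  \<open>J (min r m)\<close> exceeds the level \<open>min r m\<close>.\<close>

lemma chain_of_region_of_chain: "chain_of_region Pos m (region_of_chain Pos m J) = J"
proof
  fix r
  obtain x where x: "x \<in> region_of_chain Pos m J" using region_of_chain_nonempty by blast
  \<comment> \<open>The normalization of \<open>J\<close> beyond \<open>m\<close> matches the cap
    \<open>min r m\<close> in \<open>chain_of_region\<close>.\<close>
  have "J r = J (min r m)" using J by (auto simp: geometric_chain_def min_def)
  moreover have "a \<in> chain_of_region Pos m (region_of_chain Pos m J) r \<longleftrightarrow> a \<in> J (min r m)" for a
  proof
    assume "a \<in> chain_of_region Pos m (region_of_chain Pos m J) r"
    then have "a \<in> Pos" "a \<bullet> x < real (min r m)" using x unfolding chain_of_region_def by blast+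
    then show "a \<in> J (min r m)" using region_of_chain_inner(1)[OF x, of a "min r m"] by force
  next
    assume a: "a \<in> J (min r m)"
    then have "a \<in> Pos" using chain_subset[of "min r m"] by auto
    then show "a \<in> chain_of_region Pos m (region_of_chain Pos m J) r"
      using region_of_chain_inner(2)[OF _ _ a] by (simp add: chain_of_region_def)
  qed
  ultimately show "chain_of_region Pos m (region_of_chain Pos m J) r = J r" by blast
qed

lemma convex_region_of_chain: "convex (region_of_chain Pos m J)"
proof -
  have "region_of_chain Pos m J = (\<Inter>r\<in>{..m}. (\<Inter>a\<in>chain_I Pos m J r. {x. a \<bullet> x > real r}) \<inter>
     (\<Inter>a\<in>J r. {x. a \<bullet> x > 0} \<inter> {x. a \<bullet> x < real r}))"
    by (auto simp: region_of_chain_def)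
  then show ?thesis
    by (auto intro!: convex_INT convex_Int convex_halfspace_gt convex_halfspace_lt)
qed

lemma region_of_chain_avoids:
  "region_of_chain Pos m J \<subseteq> UNIV - \<Union> (arrangement_hyperplanes Phi m)"
proof -
  have "a \<bullet> x \<noteq> real k" if x: "x \<in> region_of_chain Pos m J" and a: "a \<in> Phi" and k: "k \<le> m" for x a k
  proof (rule Phi_cases[OF a])
    assume "a \<in> Pos"
    then show ?thesis using region_of_chain_inner[OF x] k by fastforce
  next
    assume "- a \<in> Pos"
    then have "- a \<bullet> x > 0"
      using subsetD[OF region_of_chain_dominant x] by (simp only: dominant_chamber_def mem_Collect_eq)
    then show ?thesis by simp
  qed
  then show ?thesis unfolding subset_iff avoids_arrangement_iff by blast
qed

end

text \<open>By the intermediate value property, a connected set missing a hyperplane stays strictly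
  on one side of it.\<close>

lemma region_side:
  assumes C: "connected C" "C \<subseteq> UNIV - \<Union> (arrangement_hyperplanes Phi m)"
    and x: "x \<in> C" "y \<in> C" and a: "a \<in> Phi" "k \<le> m"
  shows "real k < a \<bullet> x \<longleftrightarrow> real k < a \<bullet> y" "a \<bullet> x < real k \<longleftrightarrow> a \<bullet> y < real k"
proof -
  have ne: "a \<bullet> z \<noteq> real k" if "z \<in> C" for z
    using subsetD[OF C(2) that] a unfolding avoids_arrangement_iff by blast
  have "\<not> (a \<bullet> y \<le> real k \<and> real k \<le> a \<bullet> x)" "\<not> (a \<bullet> x \<le> real k \<and> real k \<le> a \<bullet> y)"
    using connected_ivt_hyperplane[OF C(1)] x ne by blast+
  then show "real k < a \<bullet> x \<longleftrightarrow> real k < a \<bullet> y" "a \<bullet> x < real k \<longleftrightarrow> a \<bullet> y < real k"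
    using ne[OF x(1)] ne[OF x(2)] by linarith+
qed

text \<open>Each defining inequality, including positivity at level 0, selects a side of an
  arrangement hyperplane, which cannot change within \<open>C\<close>. This gives the maximality
  required of a component.\<close>

lemma region_of_chain_side_closed:
  assumes J: "geometric_chain Pos m J" and C: "connected C" "C \<subseteq> UNIV - \<Union> (arrangement_hyperplanes Phi m)"
    and x: "x \<in> C" "x \<in> region_of_chain Pos m J"
  shows "C \<subseteq> region_of_chain Pos m J"
proof
  fix y assume y: "y \<in> C"
  note sd = region_side[OF C x(1) y]
  show "y \<in> region_of_chain Pos m J"
    unfolding region_of_chain_def
  proof (intro CollectI allI impI conjI ballI)
    fix r a assume r: "r \<le> m"
    show "real r < a \<bullet> y" if "a \<in> chain_I Pos m J r"
      using that r x(2) sd(1)[of a r] PosD(1) by (auto simp: region_of_chain_def chain_I_def)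
    show "0 < a \<bullet> y" if "a \<in> J r"
      using that r x(2) sd(1)[of a 0] chain_subset[OF J r] PosD(1) by (auto simp: region_of_chain_def)
    show "a \<bullet> y < real r" if "a \<in> J r"
      using that r x(2) sd(2)[of a r] chain_subset[OF J r] PosD(1) by (auto simp: region_of_chain_def)
  qed
qed

lemma region_of_chain_component:
  assumes J: "geometric_chain Pos m J"
  shows "region_of_chain Pos m J \<in> arrangement_regions Phi m"
proof -
  let ?R = "region_of_chain Pos m J"
  have "D = ?R" if D: "?R \<subseteq> D" "D \<subseteq> UNIV - \<Union> (arrangement_hyperplanes Phi m)" "connected D" for D
    using region_of_chain_side_closed[OF J D(3,2)] D(1) region_of_chain_nonempty[OF J] by blast
  then show ?thesis
    unfolding arrangement_regions_def in_components_maximal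
    using region_of_chain_nonempty[OF J] region_of_chain_avoids[OF J]
      convex_connected[OF convex_region_of_chain[OF J]] by blast
qed

lemma region_of_chain_bounded:
  assumes J: "geometric_chain Pos m J" and "simple_roots Pos \<subseteq> J m"
  shows "bounded (region_of_chain Pos m J)"
proof (rule bounded_if_inner_bounded_on_spanning[OF fin(3) span_simple])
  fix b x assume "b \<in> simple_roots Pos" "x \<in> region_of_chain Pos m J"
  then have "0 < b \<bullet> x \<and> b \<bullet> x < real m" using assms(2) unfolding region_of_chain_def by blast
  then show "\<bar>b \<bullet> x\<bar> \<le> real m" by simp
qed

section \<open>The chain read off from a bounded dominant region\<close>

context
  fixes R assumes R: "R \<in> bounded_dominant_regions Phi Pos m"
begin

lemma region_props:
  "R \<noteq> {}" "connected R" "R \<subseteq> UNIV - \<Union> (arrangement_hyperplanes Phi m)"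
  "R \<subseteq> dominant_chamber Pos" "bounded R"
  using R unfolding bounded_dominant_regions_def arrangement_regions_def
  by (auto simp: in_components_maximal)

text \<open>No hyperplane of the arrangement separates points of \<open>R\<close>, so one sample
  point decides membership and the chain axioms reduce to real inequalities at that point.\<close>

lemma mem_chain_of_region:
  assumes x: "x \<in> R"
  shows "a \<in> chain_of_region Pos m R r \<longleftrightarrow> a \<in> Pos \<and> a \<bullet> x < real (min r m)"
proof -
  have "a \<bullet> y < real (min r m)" if "a \<in> Pos" "a \<bullet> x < real (min r m)" "y \<in> R" for y
    using region_side(2)[OF region_props(2,3) x that(3), of a "min r m"] that PosD(1) by simp
  then show ?thesis using x by (auto simp: chain_of_region_def)
qed

lemma not_mem_chain_of_region:
  assumes x: "x \<in> R" and a: "a \<in> Pos"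
  shows "a \<notin> chain_of_region Pos m R r \<longleftrightarrow> real (min r m) < a \<bullet> x"
proof -
  have "a \<bullet> x \<noteq> real (min r m)"
    using subsetD[OF region_props(3) x] PosD(1)[OF a] min.cobounded2 unfolding avoids_arrangement_iff by blast
  then show ?thesis using mem_chain_of_region[OF x, of a r] a by auto
qed

lemma simple_less_on_region:
  assumes a: "a \<in> simple_roots Pos" and x: "x \<in> R"
  shows "a \<bullet> x < real m"
proof (rule ccontr)
  assume "\<not> ?thesis"
  then have am: "a \<bullet> x > real m"
    using not_mem_chain_of_region[OF x simple_rootsD[OF a], of m] mem_chain_of_region[OF x, of a m] by auto
  obtain w where w: "a \<bullet> w > 0" "\<And>b. b \<in> simple_roots Pos \<Longrightarrow> b \<noteq> a \<Longrightarrow> b \<bullet> w = 0"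
    using fundamental_direction[OF a] by metis
  \<comment> \<open>Along this ray, roots orthogonal to \<open>w\<close> keep their values, while
    positive roots involving \<open>a\<close> start above level \<open>m\<close> and never decrease.
    The ray therefore meets no hyperplane and stays in \<open>R\<close>.\<close>
  define L where "L = (\<lambda>t. x + t *\<^sub>R w) ` {0..}"
  have dom: "x \<in> dominant_chamber Pos" using region_props(4) x by blast
  have pos: "b \<bullet> y \<noteq> real k \<and> b \<bullet> y > 0" if b: "b \<in> Pos" and y: "y \<in> L" and k: "k \<le> m" for b y k
  proof -
    obtain t where t: "t \<ge> 0" "y = x + t *\<^sub>R w" using y by (auto simp: L_def)
    have bw: "b \<bullet> w \<ge> 0" "b \<bullet> w > 0 \<Longrightarrow> b \<bullet> x \<ge> a \<bullet> x"
      using fundamental_direction_pos[OF a w dom b] by auto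
    have bx: "b \<bullet> x > 0" using dom b by (auto simp: dominant_chamber_def)
    have by_eq: "b \<bullet> y = b \<bullet> x + t * (b \<bullet> w)" by (simp add: t inner_add_right)
    show ?thesis
    proof (cases "b \<bullet> w = 0")
      case True
      have "b \<bullet> x \<noteq> real k"
        using subsetD[OF region_props(3) x] PosD(1)[OF b] k unfolding avoids_arrangement_iff by blast
      then show ?thesis using True by_eq bx by simp
    next
      case False
      then have "b \<bullet> x > real m" using bw am by simp
      moreover have "t * (b \<bullet> w) \<ge> 0" using t bw by simp
      ultimately show ?thesis using by_eq bx k by auto
    qed
  qed
  have "b \<bullet> y \<noteq> real k" if "b \<in> Phi" "y \<in> L" "k \<le> m" for b y k
  proof (rule Phi_cases[OF that(1)])
    assume "- b \<in> Pos"
    then have "- b \<bullet> y > 0" using pos that by blast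
    then show ?thesis by simp
  qed (use pos that in blast)
  then have avoid: "L \<subseteq> UNIV - \<Union> (arrangement_hyperplanes Phi m)"
    unfolding subset_iff avoids_arrangement_iff by blast
  have "connected L" unfolding L_def
    by (intro connected_continuous_image continuous_intros) simp
  moreover have "x \<in> L" unfolding L_def by (rule image_eqI[of _ _ 0]) auto
  ultimately have "L \<subseteq> R"
    using components_maximal[of R "UNIV - \<Union> (arrangement_hyperplanes Phi m)" L] avoid x R
    unfolding bounded_dominant_regions_def arrangement_regions_def by blast
  then obtain B where B: "\<And>y. y \<in> L \<Longrightarrow> norm y \<le> B"
    using bounded_subset[OF region_props(5)] by (metis bounded_iff)
  \<comment> \<open>Chosen so that \<open>a\<close> takes a value of at least
    \<open>norm a * B + 1\<close> at \<open>x + t *\<^sub>R w\<close>, beyond the Cauchy-Schwarz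
    bound on \<open>R\<close>.\<close>
  define t where "t = (norm a * B + 1 + \<bar>a \<bullet> x\<bar>) / (a \<bullet> w)"
  have B0: "B \<ge> 0" using B[OF \<open>x \<in> L\<close>] norm_ge_zero[of x] by linarith
  then have "t \<ge> 0" using w(1) by (simp add: t_def)
  then have tL: "x + t *\<^sub>R w \<in> L" unfolding L_def by (intro imageI) simp
  have "a \<bullet> (x + t *\<^sub>R w) = a \<bullet> x + (norm a * B + 1 + \<bar>a \<bullet> x\<bar>)"
    using w(1) by (simp add: t_def inner_add_right)
  moreover have "a \<bullet> (x + t *\<^sub>R w) \<le> norm a * B"
    using norm_cauchy_schwarz[of a "x + t *\<^sub>R w"] mult_left_mono[OF B[OF tL], of "norm a"] by simp
  ultimately show False by linarith
qed

lemma chain_of_region_geometric: "geometric_chain Pos m (chain_of_region Pos m R)"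
proof -
  obtain x where x: "x \<in> R" using region_props(1) by blast
  note mem = mem_chain_of_region[OF x]
  note nmem = not_mem_chain_of_region[OF x]
  have dom: "a \<bullet> x > 0" if "a \<in> Pos" for a
    using that x region_props(4) by (auto simp: dominant_chamber_def)
  show ?thesis unfolding geometric_chain_def
  proof (intro conjI allI impI)
    show "chain_of_region Pos m R 0 = {}" using mem[of _ 0] dom by force
    show "chain_of_region Pos m R i \<subseteq> chain_of_region Pos m R (Suc i)" for i
    proof
      fix a assume "a \<in> chain_of_region Pos m R i"
      then have a: "a \<in> Pos" "a \<bullet> x < real (min i m)" using mem by auto
      moreover have "real (min i m) \<le> real (min (Suc i) m)" by simp
      ultimately have "a \<bullet> x < real (min (Suc i) m)" by linarith
      then show "a \<in> chain_of_region Pos m R (Suc i)" using mem a by blast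
    qed
    show "root_ideal Pos (chain_of_region Pos m R i)" for i
      unfolding root_ideal_def
    proof (intro conjI ballI impI)
      show "chain_of_region Pos m R i \<subseteq> Pos" using mem by blast
      fix b a assume b: "b \<in> chain_of_region Pos m R i" and a: "a \<in> Pos" and "root_le Pos a b"
      then obtain c where c: "\<forall>g\<in>Pos. c g \<ge> (0::real)" "b - a = (\<Sum>g\<in>Pos. c g *\<^sub>R g)"
        unfolding root_le_def by blast
      have "(b - a) \<bullet> x \<ge> 0" unfolding c(2) inner_sum_left
        using c(1) dom by (intro sum_nonneg) (simp add: less_imp_le)
      then have "a \<bullet> x \<le> b \<bullet> x" by (simp add: inner_diff_left)
      moreover have "b \<bullet> x < real (min i m)" using b mem by blast
      ultimately have "a \<bullet> x < real (min i m)" by linarith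
      then show "a \<in> chain_of_region Pos m R i" using a mem by blast
    qed
    show "setsum (chain_of_region Pos m R i) (chain_of_region Pos m R j) \<inter> Pos
        \<subseteq> chain_of_region Pos m R (i + j)" if "i + j \<le> m" for i j
    proof
      fix d assume "d \<in> setsum (chain_of_region Pos m R i) (chain_of_region Pos m R j) \<inter> Pos"
      then obtain a b where ab: "d = a + b" "d \<in> Pos" "a \<bullet> x < real (min i m)" "b \<bullet> x < real (min j m)"
        unfolding setsum_def using mem by blast
      \<comment> \<open>As \<open>i + j \<le> m\<close>, no level is capped and the upper bounds add
        exactly.\<close>
      have "real (min i m) + real (min j m) = real (min (i + j) m)" using that by simp
      then have "d \<bullet> x < real (min (i + j) m)" using ab(3,4) inner_add_left[of a b x] unfolding ab(1) by linarith
      then show "d \<in> chain_of_region Pos m R (i + j)" using ab(2) mem by blast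
    qed
    show "setsum (chain_I Pos m (chain_of_region Pos m R) i) (chain_I Pos m (chain_of_region Pos m R) j) \<inter> Pos
        \<subseteq> chain_I Pos m (chain_of_region Pos m R) (i + j)" for i j
    proof
      have I: "a \<in> chain_I Pos m (chain_of_region Pos m R) k \<longleftrightarrow> a \<in> Pos \<and> real (min k m) < a \<bullet> x" for a k
        using nmem[of a "min k m"] by (auto simp: chain_I_def)
      fix d assume "d \<in> setsum (chain_I Pos m (chain_of_region Pos m R) i) (chain_I Pos m (chain_of_region Pos m R) j) \<inter> Pos"
      then obtain a b where ab: "d = a + b" "d \<in> Pos" "real (min i m) < a \<bullet> x" "real (min j m) < b \<bullet> x"
        unfolding setsum_def using I by blast
      \<comment> \<open>Capped levels are subadditive, which is the direction lower bounds require,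
        so \<open>i\<close> and \<open>j\<close> may be arbitrary.\<close>
      have "real (min (i + j) m) \<le> real (min i m) + real (min j m)" by simp
      then have "real (min (i + j) m) < d \<bullet> x" using ab(3,4) inner_add_left[of a b x] unfolding ab(1) by linarith
      then show "d \<in> chain_I Pos m (chain_of_region Pos m R) (i + j)" using ab(2) I by blast
    qed
    show "chain_of_region Pos m R i = chain_of_region Pos m R m" if "m < i" for i
      using that by (simp add: chain_of_region_def)
  qed
qed

lemma chain_of_region_positive: "chain_of_region Pos m R \<in> positive_geometric_chains Pos m"
proof -
  have "simple_roots Pos \<subseteq> chain_of_region Pos m R m"
    using simple_less_on_region simple_rootsD by (auto simp: chain_of_region_def)
  then show ?thesis using chain_of_region_geometric by (simp add: positive_geometric_chains_def)
qed

text \<open>Both sides are components of the complement of the arrangement and share a sample point,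
  so they coincide.\<close>

lemma region_of_chain_of_region: "region_of_chain Pos m (chain_of_region Pos m R) = R"
proof -
  let ?R = "region_of_chain Pos m (chain_of_region Pos m R)"
  obtain x where x: "x \<in> R" using region_props(1) by blast
  have "x \<in> ?R"
    unfolding region_of_chain_def
  proof (intro CollectI allI impI conjI ballI)
    fix r a assume r: "r \<le> m"
    show "real r < a \<bullet> x" if "a \<in> chain_I Pos m (chain_of_region Pos m R) r"
      using that r not_mem_chain_of_region[OF x, of a r] by (auto simp: chain_I_def min_def)
    show "0 < a \<bullet> x" if "a \<in> chain_of_region Pos m R r"
      using that mem_chain_of_region[OF x] x region_props(4) by (auto simp: dominant_chamber_def)
    show "a \<bullet> x < real r" if "a \<in> chain_of_region Pos m R r"
      using that r mem_chain_of_region[OF x, of a r] by (auto simp: min_def)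
  qed
  moreover have "?R \<in> arrangement_regions Phi m" "R \<in> arrangement_regions Phi m"
    using region_of_chain_component[OF chain_of_region_geometric] R
    by (auto simp: bounded_dominant_regions_def)
  ultimately show ?thesis using x components_eq unfolding arrangement_regions_def by blast
qed

end

section \<open>The bijection\<close>

lemma region_of_chain_bounded_dominant:
  assumes "J \<in> positive_geometric_chains Pos m"
  shows "region_of_chain Pos m J \<in> bounded_dominant_regions Phi Pos m"
  using assms region_of_chain_component region_of_chain_dominant region_of_chain_bounded
  by (simp add: positive_geometric_chains_def bounded_dominant_regions_def)

end

theorem theorem3p6:
  fixes Phi Pos :: "'a::euclidean_space set" and m :: nat
  assumes "crystallographic_root_system Phi"
    and "irreducible_root_system Phi"
    and "positive_system Phi Pos"
    and "m \<ge> 1"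
  shows "bij_betw (region_of_chain Pos m) (positive_geometric_chains Pos m)
                  (bounded_dominant_regions Phi Pos m)
       \<and> (\<forall>R\<in>bounded_dominant_regions Phi Pos m.
            chain_of_region Pos m R \<in> positive_geometric_chains Pos m
          \<and> region_of_chain Pos m (chain_of_region Pos m R) = R)
       \<and> (\<forall>J\<in>positive_geometric_chains Pos m.
            chain_of_region Pos m (region_of_chain Pos m J) = J)"
proof -
  obtain v where "\<forall>\<alpha>\<in>Phi. \<alpha> \<bullet> v \<noteq> 0" "Pos = {\<alpha>\<in>Phi. \<alpha> \<bullet> v > 0}"
    using assms(3) unfolding positive_system_def by blast
  then interpret root_positive_system Phi Pos v m
    using assms(1) by unfold_locales auto
  have inv: "\<forall>J\<in>positive_geometric_chains Pos m. chain_of_region Pos m (region_of_chain Pos m J) = J"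
    using chain_of_region_of_chain by (simp add: positive_geometric_chains_def)
  have "bij_betw (region_of_chain Pos m) (positive_geometric_chains Pos m)
      (bounded_dominant_regions Phi Pos m)"
    using inv region_of_chain_of_region region_of_chain_bounded_dominant chain_of_region_positive
    by (intro bij_betw_byWitness[of _ "chain_of_region Pos m"]) auto
  then show ?thesis using inv chain_of_region_positive region_of_chain_of_region by blast
qed

end
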